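(* Let $\chi\colon K^m\otimes K^n\to K^n\otimes K^m$ be a quasi-standard twisting map, let $u,v,l\in\{1,\dots,m\}$, $k\in J_u(u)$, $d\in J_v(v)$, and assume that the quiver of the associated standard twisting map $\hat\chi$ has the arrows $\alpha_{kv}$ from $(k,u)$ to $(d,v)$, $\alpha_{kl}$ from $(k,u)$ to $(c_k,l)$ and $\alpha_{dl}$ from $(d,v)$ to $(c_d,l)$, where $c_k=c_k(A_\chi(l,l))$ and $c_d=c_d(A_\chi(l,l))$. Assume moreover that the submatrix $D^{uv}_{(u,l)}=A_\chi(u,l)|_{J_u(l)\times J_v(l)}$ is zero. Let $\lambda\in K$ with $\lambda\neq0$, and let $\chi_1\colon K^m\otimes K^n\to K^n\otimes K^m$ be the linear map determined by $A_{\chi_1}(u,l)_{kd}=\lambda$, $A_{\chi_1}(v,l)_{kd}=-\lambda$, $A_{\chi_1}(v,l)_{kc_k}=\lambda$, $A_{\chi_1}(u,l)_{kc_k}=A_\chi(u,l)_{kc_k}-\lambda$, and $A_{\chi_1}(i,t)_{js}=A_\chi(i,t)_{js}$ if $(i,t,j,s)\notin\{(u,l,k,d),(v,l,k,d),(v,l,k,c_k),(u,l,k,c_k)\}$. If $\chi_1$ is a quasi-standard twisting map, then (1) $A_{\chi_1}(i,u)_{kj}=A_{\hat\chi}(i,u)_{kj}$ and $A_{\chi_1}(i,v)_{kj}=A_{\hat\chi}(i,v)_{kj}$ for all $i\in\{1,\dots,m\}$, $j\in\{1,\dots,n\}$; (2) $A_{\chi_1}(u,l)$, $A_{\chi_1}(v,l)$,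 $B_{\chi_1}(d,k)$ and $B_{\chi_1}(c_k,k)$ are idempotent matrices. Moreover, condition (2) implies that $\chi_1$ is a (quasi-standard) twisting map.
   Context: $K$ is a field, $m,n$ positive integers, $K^m,K^n$ product algebras with canonical bases $\{e_i\}$, $\{f_j\}$; $\mathbf 1$ is the all-ones column vector. For unital $K$-algebras $A,C$, a twisting map of $C$ with $A$ is a $K$-linear map $\chi\colon C\otimes A\to A\otimes C$ such that $\chi\circ(\eta_C\otimes A)=A\otimes\eta_C$, $\chi\circ(C\otimes\eta_A)=\eta_A\otimes C$, $\chi\circ(\mu_C\otimes A)=(A\otimes\mu_C)\circ(\chi\otimes C)\circ(C\otimes\chi)$ and $\chi\circ(C\otimes\mu_A)=(\mu_A\otimes C)\circ(A\otimes\chi)\circ(\chi\otimes A)$. For a linear map $\chi\colon K^m\otimes K^n\to K^n\otimes K^m$ write $\chi(e_i\otimes f_j)=\sum_{k,l}\lambda_{ij}^{kl}f_k\otimes e_l$ and define $A_\chi(i,l)\in M_n(K)$, $B_\chi(j,k)\in M_m(K)$ by $A_\chi(i,l)_{kj}=\lambda_{ij}^{kl}=B_\chi(j,k)_{li}$; the $A_\chi(i,l)$ determine $\chi$. If $\chi$ is a twisting map, then for each $l$ the $A_\chi(i,l)$ are orthogonal idempotents with sum the identity and $A_\chi(i,l)\mathbf 1=\delta_{il}\mathbf 1$. Put $J_i(l)=\{j:A_\chi(i,l)_{jj}=1\}$. For a $0,1$-matrix $A$ with exactly one $1$ in each row, $c_k(A)$ denotes the column index of the $1$ in row $k$. Quasi-standard: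 for fixed $l_0$ and all $i,u,v$ put $D^{uv}_{(i)}=D^{uv}_{(i,l_0)}=A_\chi(i,l_0)|_{J_u(l_0)\times J_v(l_0)}$. The $l_0$-th column $(A_\chi(i,l_0))_{i}$ is quasi-standard if (1) $A_\chi(l_0,l_0)$ is a $0,1$-matrix with exactly one $1$ in each row; (2) $A_\chi(i,l_0)_{kk}\in\{0,1\}$ for all $i,k$; (3) $D^{uv}_{(i)}=0$ if $u\ne i$ and $v\notin\{i,l_0\}$; (4) for $u,i\in\{1,\dots,m\}$, $v\in\{1,\dots,m\}\setminus\{l_0\}$ and $k\in J_u(l_0)$, row $k$ of $D^{uv}_{(i)}$ has at most one non-zero entry, and if that entry is in column $d$ then $c_d(A_\chi(l_0,l_0))=c_k(A_\chi(l_0,l_0))$. The twisting map $\chi$ is quasi-standard if all its columns $l_0=1,\dots,m$ are. For a quasi-standard $\chi$, for each $k,l$ there is a unique index $i(k,l)$ with $A_\chi(i(k,l),l)_{kk}=1$. A twisting map is standard if for every $l$: $A_\chi(l,l)$ is a $0,1$-matrix with exactly one $1$ in each row and the support (set of positions of non-zero entries) of each $A_\chi(i,l)$ is contained in the union of the support of $A_\chi(l,l)$ and the diagonal. For a quasi-standard $\chi$, $\hat\chi$ is the standard twisting map with $A_{\hat\chi}(i,i)=A_\chi(i,i)$ and $B_{\hat\chi}(k,k)=B_\chi(k,k)$ for all $i,k$; explicitly $A_{\hat\chi}(l,l)=A_\chi(l,l)$, $A_{\hat\chi}(i,l)_{kk}=B_\chi(k,k)_{li}$, $A_{\hat\chi}(i,l)_{kj}=-1$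 if $i\ne l$, $k\ne j$ and $A_\chi(l,l)_{kj}=B_\chi(k,k)_{li}=1$, and $A_{\hat\chi}(i,l)_{kj}=0$ in the remaining cases. The quiver of $\hat\chi$ has vertex set $\{(j,i)\in\{1,\dots,n\}\times\{1,\dots,m\}:j\in J_i(i)\}$ and one arrow $\alpha_{jl}$ for each $l\in\{1,\dots,m\}$ and $j\in\{1,\dots,n\}\setminus J_l(l)$, with source $(j,i(j,l))$ and target $(c_j(A_\chi(l,l)),l)$. *)

theory Defs
  imports "HOL-Analysis.Analysis" "Graph_Theory.Digraph"
begin

section \<open>Tensor products of coordinate spaces\<close>

text \<open>
  The product algebra $K^m$ is \<^typ>\<open>'k::field ^ 'm\<close> with its library (pointwise) ring
  structure, whose unit is the all-ones vector; its canonical basis consists of the vectors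
  \<^term>\<open>axis i 1\<close>. The tensor product of $K^I$ and $K^J$ is modelled by $K^{I \times J}$, with
  pure tensors given by the Kronecker product of vectors.
\<close>

definition tensor :: "'k::field ^ 'i::finite \<Rightarrow> 'k ^ 'j::finite \<Rightarrow> 'k ^ ('i \<times> 'j)"  (infixr "\<otimes>\<^sub>v" 75) where
  "x \<otimes>\<^sub>v y = (\<chi> p. x $ fst p * y $ snd p)"

abbreviation klinear :: "('k::field ^ 'i \<Rightarrow> 'k ^ 'j) \<Rightarrow> bool" where
  "klinear \<equiv> Vector_Spaces.linear (*s) (*s)"

text \<open>$f \otimes g$ for linear $f$, $g$, given by its values on the basis of pure tensors; see
  \<open>tensor_map_tensor\<close> below.\<close>

definition tensor_map ::
  "('k::field ^ 'i::finite \<Rightarrow> 'k ^ 'j::finite) \<Rightarrow> ('k ^ 'p::finite \<Rightarrow> 'k ^ 'q::finite) \<Rightarrow> 'k ^ ('i \<times> 'p) \<Rightarrow> 'k ^ ('j \<times> 'q)"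
  where
  "tensor_map f g z = (\<Sum>p\<in>UNIV. z $ p *s (f (axis (fst p) 1) \<otimes>\<^sub>v g (axis (snd p) 1)))"

definition tensor_assoc :: "'k::field ^ (('i::finite \<times> 'j::finite) \<times> 'p::finite) \<Rightarrow> 'k ^ ('i \<times> ('j \<times> 'p))" where
  "tensor_assoc z = (\<chi> p. z $ ((fst p, fst (snd p)), snd (snd p)))"

definition tensor_assoc_inv :: "'k::field ^ ('i::finite \<times> ('j::finite \<times> 'p::finite)) \<Rightarrow> 'k ^ (('i \<times> 'j) \<times> 'p)" where
  "tensor_assoc_inv z = (\<chi> p. z $ (fst (fst p), (snd (fst p), snd p)))"

text \<open>The multiplication of the product algebra as a linear map on the tensor square.\<close>

definition mult_map :: "'k::field ^ ('i::finite \<times> 'i) \<Rightarrow> 'k ^ 'i" where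
  "mult_map z = (\<Sum>p\<in>UNIV. z $ p *s (axis (fst p) 1 * axis (snd p) 1))"

lemma axis_tensor_axis: "axis i 1 \<otimes>\<^sub>v axis j 1 = (axis (i, j) 1 :: 'k::field ^ ('i::finite \<times> 'j::finite))"
  by (auto simp: tensor_def axis_def vec_eq_iff)

lemma tensor_assoc_tensor: "tensor_assoc ((x \<otimes>\<^sub>v y) \<otimes>\<^sub>v z) = x \<otimes>\<^sub>v (y \<otimes>\<^sub>v z)"
  by (simp add: tensor_assoc_def tensor_def vec_eq_iff mult.assoc)

lemma tensor_assoc_inv_tensor: "tensor_assoc_inv (x \<otimes>\<^sub>v (y \<otimes>\<^sub>v z)) = (x \<otimes>\<^sub>v y) \<otimes>\<^sub>v z"
  by (simp add: tensor_assoc_inv_def tensor_def vec_eq_iff mult.assoc)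

lemma klinear_expand:
  fixes f :: "'k::field ^ 'i \<Rightarrow> 'k ^ 'j"
  assumes "klinear f"
  shows "f x = (\<Sum>i\<in>UNIV. x $ i *s f (axis i 1))"
proof -
  have "f x = f (\<Sum>i\<in>UNIV. x $ i *s axis i 1)"
    by (simp add: basis_expansion)
  also have "\<dots> = (\<Sum>i\<in>UNIV. x $ i *s f (axis i 1))"
    using assms by (simp add: Vector_Spaces.linear.axioms linear_sum linear_scale
        module_hom.sum module_hom.scale Vector_Spaces.linear_iff_module_hom)
  finally show ?thesis .
qed

lemma tensor_map_tensor:
  assumes "klinear f" and "klinear g"
  shows "tensor_map f g (x \<otimes>\<^sub>v y) = f x \<otimes>\<^sub>v g y"
  unfolding klinear_expand[OF assms(1), of x] klinear_expand[OF assms(2), of y]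
  by (simp add: tensor_map_def tensor_def vec_eq_iff sum_product sum.cartesian_product
      UNIV_Times_UNIV[symmetric] case_prod_beta mult_ac del: UNIV_Times_UNIV)

lemma mult_map_tensor: "mult_map (x \<otimes>\<^sub>v y) = x * y"
proof -
  have "mult_map (x \<otimes>\<^sub>v y) $ r = x $ r * y $ r" for r
  proof -
    have "mult_map (x \<otimes>\<^sub>v y) $ r =
        (\<Sum>p\<in>UNIV. (x \<otimes>\<^sub>v y) $ p * (axis (fst p) 1 $ r * axis (snd p) 1 $ r))"
      by (simp add: mult_map_def)
    also have "\<dots> = (\<Sum>p\<in>UNIV. if p = (r, r) then x $ r * y $ r else 0)"
      by (rule sum.cong) (auto simp: tensor_def axis_def split: if_splits)
    finally show ?thesis by simp
  qed
  then show ?thesis by (simp add: vec_eq_iff)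
qed


section \<open>Twisting maps of $K^m$ with $K^n$\<close>

text \<open>
  Here $C = K^m$ and $A = K^n$. The unit axioms are written on elements, through the identifications
  of $K \otimes V$ and $V \otimes K$ with $V$.
\<close>

definition twisting_map :: "('k::field ^ ('m::finite \<times> 'n::finite) \<Rightarrow> 'k ^ ('n \<times> 'm)) \<Rightarrow> bool" where
  "twisting_map X \<longleftrightarrow>
     klinear X \<and>
     (\<forall>a :: 'k ^ 'n. X (1 \<otimes>\<^sub>v a) = a \<otimes>\<^sub>v 1) \<and>
     (\<forall>c :: 'k ^ 'm. X (c \<otimes>\<^sub>v 1) = 1 \<otimes>\<^sub>v c) \<and>
     X \<circ> tensor_map mult_map id =
       tensor_map id mult_map \<circ> tensor_assoc \<circ> tensor_map X id \<circ> tensor_assoc_inv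
         \<circ> tensor_map id X \<circ> tensor_assoc \<and>
     X \<circ> tensor_map id mult_map =
       tensor_map mult_map id \<circ> tensor_assoc_inv \<circ> tensor_map id X \<circ> tensor_assoc
         \<circ> tensor_map X id \<circ> tensor_assoc_inv"

definition coef ::
  "('k::field ^ ('m::finite \<times> 'n::finite) \<Rightarrow> 'k ^ ('n \<times> 'm)) \<Rightarrow> 'm \<Rightarrow> 'n \<Rightarrow> 'n \<Rightarrow> 'm \<Rightarrow> 'k" where
  "coef X i j k l = X (axis i 1 \<otimes>\<^sub>v axis j 1) $ (k, l)"

definition A_mat ::
  "('k::field ^ ('m::finite \<times> 'n::finite) \<Rightarrow> 'k ^ ('n \<times> 'm)) \<Rightarrow> 'm \<Rightarrow> 'm \<Rightarrow> 'k ^ 'n ^ 'n" where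
  "A_mat X i l = (\<chi> k j. coef X i j k l)"

definition B_mat ::
  "('k::field ^ ('m::finite \<times> 'n::finite) \<Rightarrow> 'k ^ ('n \<times> 'm)) \<Rightarrow> 'n \<Rightarrow> 'n \<Rightarrow> 'k ^ 'm ^ 'm" where
  "B_mat X j k = (\<chi> l i. coef X i j k l)"

text \<open>The linear map with prescribed matrices $A(i,l)$.\<close>

definition map_of_A ::
  "('m::finite \<Rightarrow> 'm \<Rightarrow> 'k::field ^ 'n::finite ^ 'n) \<Rightarrow> 'k ^ ('m \<times> 'n) \<Rightarrow> 'k ^ ('n \<times> 'm)" where
  "map_of_A M z = (\<chi> q. \<Sum>p\<in>UNIV. M (fst p) (snd q) $ fst q $ snd p * z $ p)"

lemma klinear_map_of_A: "klinear (map_of_A M)"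
  by unfold_locales
    (simp_all add: map_of_A_def vec_eq_iff algebra_simps sum.distrib sum_distrib_left)

lemma A_mat_map_of_A: "A_mat (map_of_A M) i l = M i l"
  unfolding A_mat_def coef_def axis_tensor_axis
  by (simp add: map_of_A_def vec_eq_iff axis_def if_distrib cong: if_cong)

lemma map_of_A_A_mat: "klinear X \<Longrightarrow> map_of_A (A_mat X) = X"
  by (rule ext, subst (2) klinear_expand)
    (simp_all add: map_of_A_def A_mat_def coef_def axis_tensor_axis vec_eq_iff mult.commute)

definition J_set :: "('k::field ^ ('m::finite \<times> 'n::finite) \<Rightarrow> 'k ^ ('n \<times> 'm)) \<Rightarrow> 'm \<Rightarrow> 'm \<Rightarrow> 'n set" where
  "J_set X i l = {j. A_mat X i l $ j $ j = 1}"

definition one_per_row :: "'k::field ^ 'n ^ 'n \<Rightarrow> bool" where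
  "one_per_row M \<longleftrightarrow> (\<forall>k j. M $ k $ j \<in> {0, 1}) \<and> (\<forall>k. \<exists>!j. M $ k $ j = 1)"

text \<open>$c_k(M)$; meaningful if \<^term>\<open>one_per_row M\<close>.\<close>

definition col_idx :: "'k::field ^ 'n ^ 'n \<Rightarrow> 'n \<Rightarrow> 'n" where
  "col_idx M k = (THE j. M $ k $ j = 1)"

text \<open>
  The block $D^{uv}_{(i)}$ is the restriction of \<^term>\<open>A_mat X i l\<close> to the rows in
  \<^term>\<open>J_set X u l\<close> and the columns in \<^term>\<open>J_set X v l\<close>.
\<close>

definition block_zero ::
  "('k::field ^ ('m::finite \<times> 'n::finite) \<Rightarrow> 'k ^ ('n \<times> 'm)) \<Rightarrow> 'm \<Rightarrow> 'm \<Rightarrow> 'm \<Rightarrow> 'm \<Rightarrow> bool" where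
  "block_zero X u v i l \<longleftrightarrow> (\<forall>k\<in>J_set X u l. \<forall>d\<in>J_set X v l. A_mat X i l $ k $ d = 0)"

definition quasi_standard_column ::
  "('k::field ^ ('m::finite \<times> 'n::finite) \<Rightarrow> 'k ^ ('n \<times> 'm)) \<Rightarrow> 'm \<Rightarrow> bool" where
  "quasi_standard_column X l \<longleftrightarrow>
     one_per_row (A_mat X l l) \<and>
     (\<forall>i k. A_mat X i l $ k $ k \<in> {0, 1}) \<and>
     (\<forall>u v i. u \<noteq> i \<and> v \<notin> {i, l} \<longrightarrow> block_zero X u v i l) \<and>
     (\<forall>u v i. v \<noteq> l \<longrightarrow>
        (\<forall>k\<in>J_set X u l.
           (\<forall>d\<in>J_set X v l. \<forall>d'\<in>J_set X v l.
              A_mat X i l $ k $ d \<noteq> 0 \<and> A_mat X i l $ k $ d' \<noteq> 0 \<longrightarrow> d = d') \<and>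
           (\<forall>d\<in>J_set X v l. A_mat X i l $ k $ d \<noteq> 0 \<longrightarrow>
              col_idx (A_mat X l l) d = col_idx (A_mat X l l) k)))"

definition quasi_standard_twisting_map ::
  "('k::field ^ ('m::finite \<times> 'n::finite) \<Rightarrow> 'k ^ ('n \<times> 'm)) \<Rightarrow> bool" where
  "quasi_standard_twisting_map X \<longleftrightarrow> twisting_map X \<and> (\<forall>l. quasi_standard_column X l)"

text \<open>$i(k,l)$; for a quasi-standard twisting map there is exactly one such index.\<close>

definition diag_idx :: "('k::field ^ ('m::finite \<times> 'n::finite) \<Rightarrow> 'k ^ ('n \<times> 'm)) \<Rightarrow> 'n \<Rightarrow> 'm \<Rightarrow> 'm" where
  "diag_idx X k l = (THE i. A_mat X i l $ k $ k = 1)"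

definition standard_twisting_map :: "('k::field ^ ('m::finite \<times> 'n::finite) \<Rightarrow> 'k ^ ('n \<times> 'm)) \<Rightarrow> bool" where
  "standard_twisting_map X \<longleftrightarrow> twisting_map X \<and>
     (\<forall>l. one_per_row (A_mat X l l) \<and>
        (\<forall>i k j. A_mat X i l $ k $ j \<noteq> 0 \<longrightarrow> A_mat X l l $ k $ j \<noteq> 0 \<or> k = j))"

text \<open>
  The standard twisting map $\hat\chi$ associated with a quasi-standard $\chi$, by the explicit
  formula for its matrices.
\<close>

definition assoc_standard ::
  "('k::field ^ ('m::finite \<times> 'n::finite) \<Rightarrow> 'k ^ ('n \<times> 'm)) \<Rightarrow> 'k ^ ('m \<times> 'n) \<Rightarrow> 'k ^ ('n \<times> 'm)" where
  "assoc_standard X = map_of_A (\<lambda>i l. \<chi> k j.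
     if i = l then A_mat X l l $ k $ j
     else if k = j then B_mat X k k $ l $ i
     else if A_mat X l l $ k $ j = 1 \<and> B_mat X k k $ l $ i = 1 then - 1
     else 0)"

lemma A_mat_assoc_standard: "A_mat (assoc_standard X) i i = A_mat X i i"
  by (simp add: assoc_standard_def A_mat_map_of_A vec_eq_iff)

lemma B_mat_diag: "B_mat X k k $ l $ i = A_mat X i l $ k $ k"
  by (simp add: A_mat_def B_mat_def)

lemma B_mat_assoc_standard: "B_mat (assoc_standard X) k k = B_mat X k k"
  by (simp add: vec_eq_iff B_mat_diag) (simp add: assoc_standard_def A_mat_map_of_A B_mat_diag)

text \<open>
  The quiver of a standard twisting map. The arc \<open>(j, l)\<close> is the arrow $\alpha_{jl}$.
\<close>

definition quiver ::
  "('k::field ^ ('m::finite \<times> 'n::finite) \<Rightarrow> 'k ^ ('n \<times> 'm)) \<Rightarrow> ('n \<times> 'm, 'n \<times> 'm) pre_digraph" where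
  "quiver X = \<lparr>
     verts = {(j, i). j \<in> J_set X i i},
     arcs = {(j, l). j \<notin> J_set X l l},
     tail = (\<lambda>(j, l). (j, diag_idx X j l)),
     head = (\<lambda>(j, l). (col_idx (A_mat X l l) j, l))\<rparr>"

definition has_arrow :: "('v, 'e) pre_digraph \<Rightarrow> 'e \<Rightarrow> 'v \<Rightarrow> 'v \<Rightarrow> bool" where
  "has_arrow Q e s t \<longleftrightarrow> e \<in> arcs Q \<and> tail Q e = s \<and> head Q e = t"

definition idempotent_mat :: "'k::field ^ 'n ^ 'n \<Rightarrow> bool" where
  "idempotent_mat M \<longleftrightarrow> M ** M = M"

end

theory Submission
  imports Defs
begin

text \<open>
  In coordinates, a linear map $\chi$ is a twisting map exactly when the matrices $A(i,l)$ have the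
  sums dictated by the units and, for every $l$, the family $(A(i,l))_i$ and, for every $k$, the
  family $(B(j,k))_j$ consist of orthogonal idempotents (\<open>twisting_map_iff\<close>). So everything reduces
  to linear algebra in these families.

  First, the hypotheses force row $k$ of $A(v,l)$ to vanish (\<open>row_zero_of_block_zero\<close>). Therefore
  passing from $\chi$ to $\chi_1$ adds $N = \lambda e_k(e_d - e_{c_k})^T$ to $A(u,l)$, subtracts it
  from $A(v,l)$, and changes no other $A(i,t)$. Reading the same four entries in the matrices $B$, it
  adds $\lambda e_l(e_v - e_u)^T$ to $B(c_k,k)$ and subtracts it from $B(d,k)$. Both changes are
  instances of one situation: two members $P$, $Q$ of a family of orthogonal idempotents are
  replaced by $P + N$ and $Q - N$, where $N$ has rank one and square zero.

  Since $N^2 = 0$, idempotence of $P + N$ means $PN + NP = N$, and similarly for $Q - N$. With the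
  rows and diagonal entries known in the present situation, these equations of rank-one matrices
  determine one column of $P$ and one row of each of $P$ and $Q$
  (\<open>shifted_idempotent_first\<close>, \<open>shifted_idempotent_second\<close>). In particular $PN = N = NQ$, and then
  orthogonality of the original family makes all the other products of $N$ with members vanish, so
  that the whole shifted family is again orthogonal (\<open>orthogonal_idempotents_shift\<close>). This proves
  that $\chi_1$ is a twisting map as soon as the four altered matrices are idempotent. It is then
  quasi-standard: the only new non-zero entries outside the columns in $J_l(l)$ are in column $d$ of
  the previously zero row $k$ of the blocks $D^{uv}_{(u)}$ and $D^{uv}_{(v)}$, and the row of $A(v,l)$ just determined gives
  $c_d = c_k$.

  Conversely, if $\chi_1$ is a twisting map, then all of its matrices $A(i,t)$ and $B(j,s)$ are
  idempotent. The comparison with $\hat\chi$ concerns row $k$ of the unchanged matrices $A(i,u)$ and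
  $A(i,v)$, that is, rows $u$ and $v$ of the matrices $B(j,k)$. Row $u$ is clear from
  $k \in J_u(u)$. Row $v$ was determined for $j = d$, and the product of $B(d,k)$ with another
  $B(j,k)$ shows that rows $u$ and $v$ of $B(j,k)$ agree.
\<close>

section \<open>Twisting maps in terms of matrices\<close>

definition orthogonal_idempotents :: "('i \<Rightarrow> 'k::field ^ 'n ^ 'n) \<Rightarrow> bool" where
  "orthogonal_idempotents E \<longleftrightarrow> (\<forall>i j. E i ** E j = (if i = j then E i else 0))"

lemma sum_UNIV_prod: "sum f (UNIV :: ('a::finite \<times> 'b::finite) set) = (\<Sum>a\<in>UNIV. \<Sum>b\<in>UNIV. f (a, b))"
  by (simp add: sum.cartesian_product case_prod_beta flip: UNIV_Times_UNIV)

lemma klinear_eqI: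
  fixes f g :: "'k::field ^ 'i \<Rightarrow> 'k ^ 'j"
  assumes "klinear f" "klinear g" "\<And>p. f (axis p 1) = g (axis p 1)"
  shows "f = g"
proof (rule ext)
  fix x
  show "f x = g x"
    unfolding klinear_expand[OF assms(1), of x] klinear_expand[OF assms(2), of x] assms(3) ..
qed

lemma klinear_tensor_map: "klinear (tensor_map f g)"
  by unfold_locales
    (simp_all add: tensor_map_def vec_eq_iff algebra_simps sum.distrib sum_distrib_left)

lemma klinear_tensor_assoc: "klinear tensor_assoc"
  by unfold_locales (simp_all add: tensor_assoc_def vec_eq_iff algebra_simps)

lemma klinear_tensor_assoc_inv: "klinear tensor_assoc_inv"
  by unfold_locales (simp_all add: tensor_assoc_inv_def vec_eq_iff algebra_simps)

lemma klinear_comp: "klinear f \<Longrightarrow> klinear g \<Longrightarrow> klinear (g \<circ> f)"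
  by (rule Vector_Spaces.linear_compose)

lemma axis_nth: "axis i x $ j = (if j = i then x else 0)"
  by (auto simp: axis_def)

lemma sum_axis:
  fixes c :: "'k::field"
  shows "(\<Sum>a\<in>UNIV. axis x c $ a * g a) = c * g x"
    and "(\<Sum>a\<in>UNIV. g a * axis x c $ a) = g x * c"
  by (simp_all add: axis_nth if_distrib if_distribR cong: if_cong)

lemma tensor_nth: "(x \<otimes>\<^sub>v y) $ (r, s) = x $ r * y $ s"
  by (simp add: tensor_def)

lemma tensor_map_nth:
  "tensor_map f g z $ (r, s) =
    (\<Sum>a\<in>UNIV. \<Sum>b\<in>UNIV. z $ (a, b) * (f (axis a 1) $ r * g (axis b 1) $ s))"
  by (simp add: tensor_map_def tensor_nth sum_UNIV_prod)

lemma tensor_map_id_right: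
  "tensor_map f id z $ (r, s) = (\<Sum>a\<in>UNIV. z $ (a, s) * f (axis a 1) $ r)"
proof -
  have "(\<Sum>b\<in>UNIV. z $ (a, b) * (f (axis a 1) $ r * id (axis b 1) $ s))
      = (\<Sum>b\<in>UNIV. axis s 1 $ b * (z $ (a, b) * f (axis a 1) $ r))" for a
    by (rule sum.cong) (auto simp: axis_nth)
  then show ?thesis by (simp add: tensor_map_nth sum_axis)
qed

lemma tensor_map_id_left:
  "tensor_map id g z $ (r, s) = (\<Sum>b\<in>UNIV. z $ (r, b) * g (axis b 1) $ s)"
proof -
  have "(\<Sum>a\<in>UNIV. z $ (a, b) * (id (axis a 1) $ r * g (axis b 1) $ s))
      = (\<Sum>a\<in>UNIV. axis r 1 $ a * (z $ (a, b) * g (axis b 1) $ s))" for b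
    by (rule sum.cong) (auto simp: axis_nth)
  then show ?thesis by (subst tensor_map_nth, subst sum.swap) (simp add: sum_axis)
qed

lemma mult_map_axis_pair:
  "mult_map (axis (i, j) 1) = (if i = j then axis i 1 else (0 :: 'k::field ^ 'i::finite))"
proof -
  have "mult_map (axis (i, j) 1) = (axis i 1 * axis j 1 :: 'k ^ 'i)"
    by (simp flip: mult_map_tensor add: axis_tensor_axis)
  then show ?thesis by (auto simp: vec_eq_iff axis_nth)
qed

lemma mult_map_axis: "mult_map (axis p 1 :: 'k::field ^ ('i::finite \<times> 'i)) $ r = axis (r, r) 1 $ p"
  by (cases p) (auto simp: mult_map_axis_pair axis_nth)

lemma tensor_map_mult_right: "tensor_map id mult_map z $ (r, t) = z $ (r, (t, t))"
  by (simp add: tensor_map_id_left mult_map_axis sum_axis)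

lemma tensor_map_mult_left: "tensor_map mult_map id z $ (t, r) = z $ ((t, t), r)"
  by (simp add: tensor_map_id_right mult_map_axis sum_axis)

lemma tensor_map_axis: "tensor_map f g (axis (a, b) 1) = f (axis a 1) \<otimes>\<^sub>v g (axis b 1)"
proof -
  have "tensor_map f g (axis (a, b) 1) $ q = (f (axis a 1) \<otimes>\<^sub>v g (axis b 1)) $ q" for q
    by (simp add: tensor_map_def sum_axis)
  then show ?thesis by (simp add: vec_eq_iff)
qed

lemma tensor_assoc_axis: "tensor_assoc (axis ((a, b), c) 1) = axis (a, (b, c)) 1"
  by (simp add: tensor_assoc_tensor flip: axis_tensor_axis)

lemma tensor_assoc_inv_axis: "tensor_assoc_inv (axis (a, (b, c)) 1) = axis ((a, b), c) 1"
  by (simp add: tensor_assoc_inv_tensor flip: axis_tensor_axis)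

lemma tensor_assoc_nth: "tensor_assoc z $ (a, (b, c)) = z $ ((a, b), c)"
  by (simp add: tensor_assoc_def)

lemma tensor_assoc_inv_nth: "tensor_assoc_inv z $ ((a, b), c) = z $ (a, (b, c))"
  by (simp add: tensor_assoc_inv_def)

lemma coef_axis: "X (axis (i, j) 1) $ (k, l) = coef X i j k l"
  by (simp add: coef_def axis_tensor_axis)

lemma klinear_coef:
  assumes "klinear X"
  shows "X z $ (k, l) = (\<Sum>i\<in>UNIV. \<Sum>j\<in>UNIV. z $ (i, j) * coef X i j k l)"
  by (subst klinear_expand[OF assms]) (simp add: sum_UNIV_prod coef_axis)

lemma unit_axiom_left_iff:
  assumes "klinear X"
  shows "(\<forall>a. X (1 \<otimes>\<^sub>v a) = a \<otimes>\<^sub>v 1) \<longleftrightarrow>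
    (\<forall>l k j. (\<Sum>i\<in>UNIV. A_mat X i l $ k $ j) = (if k = j then 1 else 0))"
proof -
  have *: "X (1 \<otimes>\<^sub>v a) $ (k, l) = (\<Sum>j\<in>UNIV. a $ j * (\<Sum>i\<in>UNIV. A_mat X i l $ k $ j))" for a k l
    unfolding klinear_coef[OF assms]
    by (subst sum.swap) (simp add: tensor_def A_mat_def sum_distrib_left)
  show ?thesis
  proof (intro iffI allI)
    fix l k j
    assume "\<forall>a. X (1 \<otimes>\<^sub>v a) = a \<otimes>\<^sub>v 1"
    then have "X (1 \<otimes>\<^sub>v axis j 1) $ (k, l) = (axis j 1 \<otimes>\<^sub>v 1) $ (k, l)" by simp
    then show "(\<Sum>i\<in>UNIV. A_mat X i l $ k $ j) = (if k = j then 1 else 0)"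
      unfolding * by (simp add: tensor_def axis_nth if_distrib if_distribR cong: if_cong)
  next
    fix a
    assume h: "\<forall>l k j. (\<Sum>i\<in>UNIV. A_mat X i l $ k $ j) = (if k = j then 1 else 0)"
    have "X (1 \<otimes>\<^sub>v a) $ (k, l) = (a \<otimes>\<^sub>v 1) $ (k, l)" for k l
      unfolding * h[rule_format] by (simp add: tensor_def if_distrib cong: if_cong)
    then show "X (1 \<otimes>\<^sub>v a) = a \<otimes>\<^sub>v 1" by (simp add: vec_eq_iff)
  qed
qed

lemma unit_axiom_right_iff:
  assumes "klinear X"
  shows "(\<forall>c. X (c \<otimes>\<^sub>v 1) = 1 \<otimes>\<^sub>v c) \<longleftrightarrow>
    (\<forall>i l k. (\<Sum>j\<in>UNIV. A_mat X i l $ k $ j) = (if i = l then 1 else 0))"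
proof -
  have *: "X (c \<otimes>\<^sub>v 1) $ (k, l) = (\<Sum>i\<in>UNIV. c $ i * (\<Sum>j\<in>UNIV. A_mat X i l $ k $ j))" for c k l
    unfolding klinear_coef[OF assms] by (simp add: tensor_def A_mat_def sum_distrib_left)
  show ?thesis
  proof (intro iffI allI)
    fix i l k
    assume "\<forall>c. X (c \<otimes>\<^sub>v 1) = 1 \<otimes>\<^sub>v c"
    then have "X (axis i 1 \<otimes>\<^sub>v 1) $ (k, l) = (1 \<otimes>\<^sub>v axis i 1) $ (k, l)" by simp
    then show "(\<Sum>j\<in>UNIV. A_mat X i l $ k $ j) = (if i = l then 1 else 0)"
      unfolding * by (auto simp add: tensor_def axis_nth if_distrib if_distribR cong: if_cong)
  next
    fix c
    assume h: "\<forall>i l k. (\<Sum>j\<in>UNIV. A_mat X i l $ k $ j) = (if i = l then 1 else 0)"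
    have "X (c \<otimes>\<^sub>v 1) $ (k, l) = (1 \<otimes>\<^sub>v c) $ (k, l)" for k l
      unfolding * h[rule_format] by (simp add: tensor_def if_distrib cong: if_cong)
    then show "X (c \<otimes>\<^sub>v 1) = 1 \<otimes>\<^sub>v c" by (simp add: vec_eq_iff)
  qed
qed

text \<open>Evaluated on $e_i \otimes e_{i'} \otimes f_j$, the two sides of the axiom have as coefficients
  the entries of $\delta_{ii'} A(i,t)$ and of $A(i,t) A(i',t)$.\<close>

lemma mult_axiom_left_iff:
  fixes X :: "'k::field ^ ('m::finite \<times> 'n::finite) \<Rightarrow> 'k ^ ('n \<times> 'm)"
  assumes "klinear X"
  shows "X \<circ> tensor_map mult_map id =
       tensor_map id mult_map \<circ> tensor_assoc \<circ> tensor_map X id \<circ> tensor_assoc_inv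
         \<circ> tensor_map id X \<circ> tensor_assoc
     \<longleftrightarrow> (\<forall>l. orthogonal_idempotents (\<lambda>i. A_mat X i l))"
    (is "?L = ?R \<longleftrightarrow> _")
proof -
  have zero: "X 0 = 0" by (subst klinear_expand[OF assms]) simp
  have L: "?L (axis ((i, i'), j) 1) $ (p, t) = (if i = i' then A_mat X i t else 0) $ p $ j" for i i' j p t
  proof -
    have "?L (axis ((i, i'), j) 1) = X ((if i = i' then axis i 1 else 0) \<otimes>\<^sub>v axis j 1)"
      by (simp add: tensor_map_axis mult_map_axis_pair)
    also have "\<dots> = (if i = i' then X (axis (i, j) 1) else 0)"
      using zero by (simp add: axis_tensor_axis) (simp add: tensor_def zero_vec_def)
    finally show ?thesis by (simp add: coef_axis A_mat_def)
  qed
  have R: "?R (axis ((i, i'), j) 1) $ (p, t) = (A_mat X i t ** A_mat X i' t) $ p $ j" for i i' j p t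
  proof -
    have "?R (axis ((i, i'), j) 1) $ (p, t)
        = tensor_map X id (tensor_assoc_inv (axis i 1 \<otimes>\<^sub>v X (axis (i', j) 1))) $ ((p, t), t)"
      by (simp add: tensor_map_mult_right tensor_assoc_nth tensor_assoc_axis tensor_map_axis)
    also have "\<dots> = (\<Sum>r\<in>UNIV. axis i 1 $ r * (\<Sum>k\<in>UNIV. coef X i' j k t * coef X r k p t))"
      by (simp add: tensor_map_id_right sum_UNIV_prod tensor_assoc_inv_nth tensor_nth coef_axis
          sum_distrib_left mult.assoc)
    also have "\<dots> = (A_mat X i t ** A_mat X i' t) $ p $ j"
      by (simp add: sum_axis matrix_matrix_mult_def A_mat_def mult.commute)
    finally show ?thesis .
  qed
  show ?thesis
  proof
    assume "?L = ?R"
    then show "\<forall>l. orthogonal_idempotents (\<lambda>i. A_mat X i l)"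
      unfolding orthogonal_idempotents_def vec_eq_iff L[symmetric] R[symmetric] by simp
  next
    assume o: "\<forall>l. orthogonal_idempotents (\<lambda>i. A_mat X i l)"
    show "?L = ?R"
    proof (rule klinear_eqI)
      show "klinear ?L" "klinear ?R"
        by (intro klinear_comp assms klinear_tensor_map klinear_tensor_assoc klinear_tensor_assoc_inv)+
      show "?L (axis q 1) = ?R (axis q 1)" for q
      proof -
        obtain i i' j where q: "q = ((i, i'), j)" by (metis prod.exhaust)
        have "?L (axis q 1) $ (p, t) = ?R (axis q 1) $ (p, t)" for p t
          unfolding q L R using o by (simp add: orthogonal_idempotents_def)
        then show ?thesis by (simp add: vec_eq_iff)
      qed
    qed
  qed
qed

text \<open>The same computation on $e_i \otimes f_{j'} \otimes f_j$; the factors appear in reverse order,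
  which does not matter for orthogonality of the whole family.\<close>

lemma mult_axiom_right_iff:
  fixes X :: "'k::field ^ ('m::finite \<times> 'n::finite) \<Rightarrow> 'k ^ ('n \<times> 'm)"
  assumes "klinear X"
  shows "X \<circ> tensor_map id mult_map =
       tensor_map mult_map id \<circ> tensor_assoc_inv \<circ> tensor_map id X \<circ> tensor_assoc
         \<circ> tensor_map X id \<circ> tensor_assoc_inv
     \<longleftrightarrow> (\<forall>k. orthogonal_idempotents (\<lambda>j. B_mat X j k))"
    (is "?L = ?R \<longleftrightarrow> _")
proof -
  have zero: "X 0 = 0" by (subst klinear_expand[OF assms]) simp
  have L: "?L (axis (i, (j', j)) 1) $ (k, t) = (if j = j' then B_mat X j k else 0) $ t $ i" for i j j' k t
  proof -
    have "?L (axis (i, (j', j)) 1) = X (axis i 1 \<otimes>\<^sub>v (if j' = j then axis j' 1 else 0))"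
      by (simp add: tensor_map_axis mult_map_axis_pair)
    also have "\<dots> = (if j = j' then X (axis (i, j) 1) else 0)"
      using zero by (simp add: axis_tensor_axis) (simp add: tensor_def zero_vec_def)
    finally show ?thesis by (simp add: coef_axis B_mat_def)
  qed
  have R: "?R (axis (i, (j', j)) 1) $ (k, t) = (B_mat X j k ** B_mat X j' k) $ t $ i" for i j j' k t
  proof -
    have "?R (axis (i, (j', j)) 1) $ (k, t)
        = tensor_map id X (tensor_assoc (X (axis (i, j') 1) \<otimes>\<^sub>v axis j 1)) $ (k, (k, t))"
      by (simp add: tensor_map_mult_left tensor_assoc_inv_nth tensor_assoc_inv_axis tensor_map_axis)
    also have "\<dots> = (\<Sum>r\<in>UNIV. \<Sum>s\<in>UNIV. axis j 1 $ s * (coef X i j' k r * coef X r s k t))"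
      by (simp add: tensor_map_id_left sum_UNIV_prod tensor_assoc_nth tensor_nth coef_axis mult_ac)
    also have "\<dots> = (B_mat X j k ** B_mat X j' k) $ t $ i"
      by (simp add: sum_axis matrix_matrix_mult_def B_mat_def mult.commute)
    finally show ?thesis .
  qed
  show ?thesis
  proof
    assume "?L = ?R"
    then show "\<forall>k. orthogonal_idempotents (\<lambda>j. B_mat X j k)"
      unfolding orthogonal_idempotents_def vec_eq_iff L[symmetric] R[symmetric] by simp
  next
    assume o: "\<forall>k. orthogonal_idempotents (\<lambda>j. B_mat X j k)"
    show "?L = ?R"
    proof (rule klinear_eqI)
      show "klinear ?L" "klinear ?R"
        by (intro klinear_comp assms klinear_tensor_map klinear_tensor_assoc klinear_tensor_assoc_inv)+
      show "?L (axis q 1) = ?R (axis q 1)" for q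
      proof -
        obtain i j' j where q: "q = (i, (j', j))" by (metis prod.exhaust)
        have "?L (axis q 1) $ (p, t) = ?R (axis q 1) $ (p, t)" for p t
          unfolding q L R using o by (simp add: orthogonal_idempotents_def)
        then show ?thesis by (simp add: vec_eq_iff)
      qed
    qed
  qed
qed

lemma twisting_map_iff:
  "twisting_map X \<longleftrightarrow> klinear X \<and>
     (\<forall>l k j. (\<Sum>i\<in>UNIV. A_mat X i l $ k $ j) = (if k = j then 1 else 0)) \<and>
     (\<forall>i l k. (\<Sum>j\<in>UNIV. A_mat X i l $ k $ j) = (if i = l then 1 else 0)) \<and>
     (\<forall>l. orthogonal_idempotents (\<lambda>i. A_mat X i l)) \<and>
     (\<forall>k. orthogonal_idempotents (\<lambda>j. B_mat X j k))"
proof (cases "klinear X")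
  case True
  show ?thesis
    unfolding twisting_map_def unit_axiom_left_iff[OF True] unit_axiom_right_iff[OF True]
      mult_axiom_left_iff[OF True] mult_axiom_right_iff[OF True] ..
qed (simp add: twisting_map_def)


section \<open>Rank-one shifts of orthogonal idempotents\<close>

text \<open>The matrix $c\,e_k (e_a - e_b)^T$.\<close>

definition shift_mat :: "'k::field \<Rightarrow> 'n \<Rightarrow> 'n \<Rightarrow> 'n \<Rightarrow> 'k ^ 'n::finite ^ 'n" where
  "shift_mat c k a b = (\<chi> r s. axis k c $ r * (axis a 1 $ s - axis b 1 $ s))"

lemma matrix_add_rdistrib: "(A + B) ** C = A ** C + B ** C"
  by (simp add: vec_eq_iff matrix_matrix_mult_def distrib_right sum.distrib)

lemma matrix_mul_shift_mat:
  "(M ** shift_mat c k a b) $ r $ s = M $ r $ k * shift_mat c k a b $ k $ s"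
  by (simp add: matrix_matrix_mult_def shift_mat_def mult.left_commute[of _ "axis k c $ _"] sum_axis)

lemma sum_axis_diff:
  fixes g :: "'i::finite \<Rightarrow> 'k::field"
  shows "(\<Sum>s\<in>UNIV. (axis a 1 $ s - axis b 1 $ s) * g s) = g a - g b"
  by (simp add: left_diff_distrib sum_subtractf sum_axis)

lemma shift_mat_mul:
  "(shift_mat c k a b ** M) $ r $ s = axis k c $ r * (M $ a $ s - M $ b $ s)"
  by (simp add: matrix_matrix_mult_def shift_mat_def mult.assoc sum_axis_diff flip: sum_distrib_left)

text \<open>The criterion is linear in $N$, so for a rank-one $N$ it can be read off entry by entry.\<close>

lemma idempotent_add_square_zero:
  fixes P N :: "'k::field ^ 'n::finite ^ 'n"
  assumes "P ** P = P" "N ** N = 0"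
  shows "idempotent_mat (P + N) \<longleftrightarrow> P ** N + N ** P = N"
proof -
  have "(P + N) ** (P + N) = P + (P ** N + N ** P)"
    using assms by (simp add: matrix_add_ldistrib matrix_add_rdistrib)
  then show ?thesis by (simp add: idempotent_mat_def)
qed

lemma shift_mat_square:
  "k \<noteq> a \<Longrightarrow> k \<noteq> b \<Longrightarrow> shift_mat c k a b ** shift_mat c k a b = 0"
  by (auto simp: vec_eq_iff shift_mat_mul) (auto simp: shift_mat_def axis_nth)

text \<open>
  With $w = e_a - e_b$ and $N = c\,e_k w^T$, the equation $PN + NP = N$ says, row $b$ of $P$ being
  zero, that $(P e_k) w^T + e_k (e_a^T P) = e_k w^T$. Its rows other than row $k$ give
  $P_{rk} = 0$, and since $P_{kk} = 1$ what remains of row $k$ is $e_a^T P = 0$.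
\<close>

lemma shifted_idempotent_first:
  fixes P :: "'k::field ^ 'n::finite ^ 'n"
  assumes "P ** P = P" and "k \<noteq> a" "k \<noteq> b" "a \<noteq> b" "c \<noteq> 0"
    and "P $ k $ k = 1" and row_b: "\<And>s. P $ b $ s = 0"
    and idem: "idempotent_mat (P + shift_mat c k a b)"
  shows "\<And>r. P $ r $ k = axis k 1 $ r" and "\<And>s. P $ a $ s = 0"
proof -
  let ?N = "shift_mat c k a b"
  have N2: "?N ** ?N = 0"
    using assms(2,3) by (rule shift_mat_square)
  have "P ** ?N + ?N ** P = ?N"
    using idem idempotent_add_square_zero[OF assms(1) N2] by simp
  then have e: "P $ r $ k * ?N $ k $ s + axis k c $ r * P $ a $ s = ?N $ r $ s" for r s
    by (metis (no_types, lifting) matrix_mul_shift_mat row_b shift_mat_mul vector_add_component diff_zero)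
  show "P $ r $ k = axis k 1 $ r" for r
    using e[of r a] assms(2-6) by (auto simp: shift_mat_def axis_nth)
  show "P $ a $ s = 0" for s
    using e[of k s] assms(2-6) by (auto simp: axis_nth)
qed

lemma shift_mat_uminus: "shift_mat (- c) k a b = - shift_mat c k a b"
  by (auto simp: vec_eq_iff shift_mat_def axis_nth)

text \<open>Here $Q_{kk} = 0$, so row $k$ of $QN + NQ = N$ reads $e_a^T Q = w^T$.\<close>

lemma shifted_idempotent_second:
  fixes Q :: "'k::field ^ 'n::finite ^ 'n"
  assumes "Q ** Q = Q" and "k \<noteq> a" "k \<noteq> b" "c \<noteq> 0"
    and "Q $ k $ k = 0" and row_b: "\<And>s. Q $ b $ s = 0"
    and idem: "idempotent_mat (Q - shift_mat c k a b)"
  shows "\<And>s. Q $ a $ s = axis a 1 $ s - axis b 1 $ s"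
proof -
  let ?N = "shift_mat (- c) k a b"
  have N2: "?N ** ?N = 0"
    using assms(2,3) by (rule shift_mat_square)
  have "idempotent_mat (Q + ?N)"
    using idem by (simp add: shift_mat_uminus)
  then have "Q ** ?N + ?N ** Q = ?N"
    using idempotent_add_square_zero[OF assms(1) N2] by simp
  then have e: "Q $ r $ k * ?N $ k $ s + axis k (- c) $ r * Q $ a $ s = ?N $ r $ s" for r s
    by (metis (no_types, lifting) matrix_mul_shift_mat row_b shift_mat_mul vector_add_component diff_zero)
  show "Q $ a $ s = axis a 1 $ s - axis b 1 $ s" for s
    using e[of k s] assms(2-5) by (auto simp: shift_mat_def axis_nth split: if_splits)
qed

text \<open>The hypotheses on $E_p$ and $E_q$ say $E_p N = N = N E_q$. For the other members,
  $E_i N = E_i E_p N = 0$ and $N E_i = N E_q E_i = 0$, and likewise $N E_p = E_q N = 0$. The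
  products of the shifted members can then be expanded; in $(E_p + N)(E_q - N)$ the two linear
  terms cancel.\<close>

lemma orthogonal_idempotents_shift:
  fixes E F :: "'i \<Rightarrow> 'k::field ^ 'n::finite ^ 'n"
  assumes orth: "orthogonal_idempotents E" and "p \<noteq> q"
    and "k \<noteq> a" "k \<noteq> b"
    and col_k: "\<And>r. E p $ r $ k = axis k 1 $ r"
    and row_a: "\<And>s. E q $ a $ s = axis a 1 $ s - axis b 1 $ s"
    and row_b: "\<And>s. E q $ b $ s = 0"
    and Fp: "F p = E p + shift_mat c k a b" and Fq: "F q = E q - shift_mat c k a b"
    and F: "\<And>i. i \<noteq> p \<Longrightarrow> i \<noteq> q \<Longrightarrow> F i = E i"
  shows "orthogonal_idempotents F"
proof -
  let ?N = "shift_mat c k a b"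
  have EE: "E i ** E j = (if i = j then E i else 0)" for i j
    using orth by (simp add: orthogonal_idempotents_def)
  have N2: "?N ** ?N = 0"
    using assms(3,4) by (rule shift_mat_square)
  have pN: "E p ** ?N = ?N"
    by (auto simp: vec_eq_iff matrix_mul_shift_mat col_k) (auto simp: shift_mat_def axis_nth)
  have Nq: "?N ** E q = ?N"
    by (auto simp: vec_eq_iff shift_mat_mul row_a row_b) (auto simp: shift_mat_def axis_nth)
  have EN: "E i ** ?N = (if i = p then ?N else 0)" for i
    using pN EE[of i p] by (metis matrix_mul_assoc times0_left)
  have NE: "?N ** E i = (if i = q then ?N else 0)" for i
    using Nq EE[of q i] by (metis matrix_mul_assoc times0_right)
  define t :: "'i \<Rightarrow> 'k ^ 'n ^ 'n" where "t i = (if i = p then ?N else if i = q then - ?N else 0)" for i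
  have F': "F i = E i + t i" for i
    using Fp Fq F[of i] by (auto simp: t_def)
  have neg: "A ** (- B) = - (A ** B)" "(- A) ** B = - (A ** B)" for A B :: "'k ^ 'n ^ 'n"
    by (simp_all add: vec_eq_iff matrix_matrix_mult_def sum_negf)
  have "F i ** F j = (if i = j then F i else 0)" for i j
    unfolding F' using \<open>p \<noteq> q\<close>
    by (auto simp: matrix_add_ldistrib matrix_add_rdistrib EE t_def neg EN NE N2)
  then show ?thesis by (simp add: orthogonal_idempotents_def)
qed


section \<open>Quasi-standard columns\<close>

lemma one_per_row_nth:
  assumes "one_per_row M"
  shows "M $ k $ j = axis (col_idx M k) 1 $ j"
proof -
  obtain c where c: "M $ k $ c = 1" and uniq: "\<And>j. M $ k $ j = 1 \<Longrightarrow> j = c"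
    using assms unfolding one_per_row_def by (meson ex1E)
  from c uniq have "col_idx M k = c"
    unfolding col_idx_def by (rule the_equality)
  moreover have "M $ k $ j \<in> {0, 1}"
    using assms unfolding one_per_row_def by (meson)
  then have "M $ k $ j = axis c 1 $ j"
  proof (cases "j = c")
    case False
    then have "M $ k $ j \<noteq> 1" using uniq by blast
    then show ?thesis using \<open>M $ k $ j \<in> {0, 1}\<close> False by (simp add: axis_nth)
  qed (simp add: axis_nth c)
  ultimately show ?thesis by simp
qed

lemma one_per_row_mul:
  assumes "one_per_row M"
  shows "(M ** N) $ k $ s = N $ col_idx M k $ s"
  by (simp add: matrix_matrix_mult_def one_per_row_nth[OF assms] sum_axis)

text \<open>The sum of the $A(i,l)_{kk}$ being $1$ does not exclude several ones in positive characteristic.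
  Instead, if $k$ lies in $J_x(l)$ and in $J_y(l)$ with $x \neq y$, then $k$ is a row and a column of
  the block $D^{yy}_{(x)}$, which vanishes in a quasi-standard column unless $y = l$, although its
  $(k,k)$ entry is $1$; by symmetry also $x = l$.\<close>

lemma J_set_disjoint:
  assumes "quasi_standard_column X l" and "k \<in> J_set X u l" and "k \<in> J_set X w l"
  shows "u = w"
proof (rule ccontr)
  assume "u \<noteq> w"
  have *: "y = l" if "k \<in> J_set X x l" "k \<in> J_set X y l" "x \<noteq> y" for x y
  proof (rule ccontr)
    assume "y \<noteq> l"
    then have "block_zero X y y x l"
      using assms(1) that by (auto simp: quasi_standard_column_def)
    then show False using that by (auto simp: block_zero_def J_set_def)
  qed
  show False using *[of u w] *[of w u] assms(2,3) \<open>u \<noteq> w\<close> by auto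
qed

lemma J_set_cover:
  assumes "twisting_map X" and "quasi_standard_column X l"
  obtains i where "k \<in> J_set X i l"
proof -
  have "(\<Sum>i\<in>UNIV. A_mat X i l $ k $ k) \<noteq> 0"
    using assms(1) by (simp add: twisting_map_iff)
  then obtain i where "A_mat X i l $ k $ k \<noteq> 0" by (meson sum.neutral)
  then have "k \<in> J_set X i l"
    using assms(2) by (auto simp: quasi_standard_column_def J_set_def)
  then show ?thesis using that by blast
qed

lemma diag_idx_eq_iff:
  assumes "twisting_map X" and "quasi_standard_column X l"
  shows "diag_idx X k l = i \<longleftrightarrow> k \<in> J_set X i l"
proof -
  have "\<exists>!i. k \<in> J_set X i l"
    using J_set_cover[OF assms] J_set_disjoint[OF assms(2)] by metis
  then show ?thesis
    using theI'[of "\<lambda>i. k \<in> J_set X i l"] by (auto simp: diag_idx_def J_set_def)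
qed

lemma J_set_diag_iff:
  assumes "one_per_row (A_mat X l l)"
  shows "k \<in> J_set X l l \<longleftrightarrow> col_idx (A_mat X l l) k = k"
  by (auto simp: J_set_def one_per_row_nth[OF assms] axis_nth split: if_splits)

text \<open>Row $k$ of $A(l,l)^2$ is row $c_k$ of $A(l,l)$; idempotence makes it equal to row $k$, which has
  its one in column $c_k$.\<close>

lemma col_idx_in_J_set:
  assumes "twisting_map X" and "one_per_row (A_mat X l l)"
  shows "col_idx (A_mat X l l) k \<in> J_set X l l"
proof -
  let ?A = "A_mat X l l"
  have "?A ** ?A = ?A"
    using assms(1) by (auto simp: twisting_map_iff orthogonal_idempotents_def)
  then have "?A $ col_idx ?A k $ col_idx ?A k = ?A $ k $ col_idx ?A k"
    using one_per_row_mul[OF assms(2), of ?A] by metis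
  then show ?thesis by (simp add: J_set_def one_per_row_nth[OF assms(2), of k] axis_nth)
qed

text \<open>For $k \in J_l(l)$, row $k$ of $A(l,l)$ is $e_k^T$, so row $k$ of $A(l,l) A(i,l) = 0$ is row $k$ of
  $A(i,l)$.\<close>

lemma row_zero_on_J_set_diag:
  assumes "twisting_map X" and "one_per_row (A_mat X l l)" and "k \<in> J_set X l l" and "i \<noteq> l"
  shows "A_mat X i l $ k $ s = 0"
proof -
  have "A_mat X l l ** A_mat X i l = 0"
    using assms(1,4) by (simp add: twisting_map_iff orthogonal_idempotents_def)
  then show ?thesis
    using one_per_row_mul[OF assms(2), of "A_mat X i l" k s] assms(3)
    by (simp add: J_set_diag_iff[OF assms(2)])
qed

text \<open>The columns in $J_l(l)$ are controlled by the others: for $j \in J_l(l)$, entry $(k,j)$ of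
  $A(i,l) A(l,l) = 0$ is the sum of $A(i,l)_{ks}$ over all $s$ with $c_s = j$, and $s = j$ is the only
  such index in $J_l(l)$.\<close>

lemma row_zero_of_off_diag_zero:
  assumes "twisting_map X" and one: "one_per_row (A_mat X l l)" and "i \<noteq> l"
    and zero: "\<And>s. s \<notin> J_set X l l \<Longrightarrow> A_mat X i l $ k $ s = 0"
  shows "A_mat X i l $ k $ j = 0"
proof (cases "j \<in> J_set X l l")
  case True
  have "A_mat X i l ** A_mat X l l = 0"
    using assms(1,3) by (simp add: twisting_map_iff orthogonal_idempotents_def)
  then have "0 = (A_mat X i l ** A_mat X l l) $ k $ j" by simp
  also have "\<dots> = (\<Sum>s\<in>UNIV. A_mat X i l $ k $ s * A_mat X l l $ s $ j)"
    by (simp add: matrix_matrix_mult_def)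
  also have "\<dots> = (\<Sum>s\<in>UNIV. if s = j then A_mat X i l $ k $ j else 0)"
  proof (rule sum.cong)
    fix s
    show "A_mat X i l $ k $ s * A_mat X l l $ s $ j = (if s = j then A_mat X i l $ k $ j else 0)"
      using zero[of s] True
      by (cases "s \<in> J_set X l l") (auto simp: J_set_diag_iff[OF one] one_per_row_nth[OF one] axis_nth)
  qed simp
  finally show ?thesis by simp
qed (rule zero)

text \<open>By the preceding lemma it is enough to look at columns outside $J_l(l)$. For $k \in J_u(l)$ with
  $u \neq v$, the blocks that must vanish in a quasi-standard column contain the entries of row $k$
  of $A(v,l)$ in $J_w(l)$ for $w \notin \{v,l\}$. In a column of $J_v(l)$ only
  $A(u,l)$ and $A(v,l)$ can have a non-zero entry in row $k$; these entries sum to $0$, and the one of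
  $A(u,l)$ vanishes by assumption.\<close>

lemma row_zero_of_block_zero:
  assumes tw: "twisting_map X" and qs: "quasi_standard_column X l"
    and k: "k \<in> J_set X u l" and "u \<noteq> v" "v \<noteq> l" and bz: "block_zero X u v u l"
  shows "A_mat X v l $ k $ j = 0"
proof (rule row_zero_of_off_diag_zero[OF tw])
  show "one_per_row (A_mat X l l)" using qs by (simp add: quasi_standard_column_def)
  show "v \<noteq> l" by fact
  fix s
  assume s: "s \<notin> J_set X l l"
  obtain w where w: "s \<in> J_set X w l" using J_set_cover[OF tw qs] .
  then have "w \<noteq> l" using s by auto
  have qs3: "A_mat X i l $ k $ s = 0" if "u \<noteq> i" "w \<noteq> i" for i
    using qs that \<open>w \<noteq> l\<close> k w by (auto simp: quasi_standard_column_def block_zero_def)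
  show "A_mat X v l $ k $ s = 0"
  proof (cases "w = v")
    case True
    have "k \<noteq> s" using J_set_disjoint[OF qs k] w True \<open>u \<noteq> v\<close> by auto
    then have "0 = (\<Sum>i\<in>UNIV. A_mat X i l $ k $ s)"
      using tw by (simp add: twisting_map_iff)
    also have "\<dots> = (\<Sum>i\<in>UNIV. if i = v then A_mat X v l $ k $ s else 0)"
    proof (rule sum.cong)
      fix i
      have "A_mat X u l $ k $ s = 0" using bz k w True by (simp add: block_zero_def)
      then show "A_mat X i l $ k $ s = (if i = v then A_mat X v l $ k $ s else 0)"
        using qs3[of i] True by auto
    qed simp
    finally show ?thesis by simp
  next
    case False
    then show ?thesis using qs3[of v] \<open>u \<noteq> v\<close> by auto
  qed
qed

section \<open>Deforming a quasi-standard twisting map\<close>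

theorem proposition7p11:
  fixes X X1 :: "'k::field ^ ('m::finite \<times> 'n::finite) \<Rightarrow> 'k ^ ('n \<times> 'm)"
    and u v l :: 'm and k d ck cd :: 'n and lam :: 'k
  assumes "quasi_standard_twisting_map X"
    and "k \<in> J_set X u u" and "d \<in> J_set X v v"
    and "ck = col_idx (A_mat X l l) k" and "cd = col_idx (A_mat X l l) d"
    and "has_arrow (quiver (assoc_standard X)) (k, v) (k, u) (d, v)"
    and "has_arrow (quiver (assoc_standard X)) (k, l) (k, u) (ck, l)"
    and "has_arrow (quiver (assoc_standard X)) (d, l) (d, v) (cd, l)"
    and "block_zero X u v u l"
    and "lam \<noteq> 0"
    and "klinear X1"
    and "A_mat X1 u l $ k $ d = lam"
    and "A_mat X1 v l $ k $ d = - lam"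
    and "A_mat X1 v l $ k $ ck = lam"
    and "A_mat X1 u l $ k $ ck = A_mat X u l $ k $ ck - lam"
    and "\<And>i t j s. (i, t, j, s) \<notin> {(u, l, k, d), (v, l, k, d), (v, l, k, ck), (u, l, k, ck)} \<Longrightarrow>
           A_mat X1 i t $ j $ s = A_mat X i t $ j $ s"
  shows "(quasi_standard_twisting_map X1 \<longrightarrow>
           (\<forall>i j. A_mat X1 i u $ k $ j = A_mat (assoc_standard X) i u $ k $ j \<and>
                  A_mat X1 i v $ k $ j = A_mat (assoc_standard X) i v $ k $ j) \<and>
           (idempotent_mat (A_mat X1 u l) \<and> idempotent_mat (A_mat X1 v l) \<and>
            idempotent_mat (B_mat X1 d k) \<and> idempotent_mat (B_mat X1 ck k))) \<and>
         ((idempotent_mat (A_mat X1 u l) \<and> idempotent_mat (A_mat X1 v l) \<and>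
           idempotent_mat (B_mat X1 d k) \<and> idempotent_mat (B_mat X1 ck k)) \<longrightarrow>
          quasi_standard_twisting_map X1)"
proof -
  note val = assms(12-15) and rest = assms(16)
  have tw: "twisting_map X" and qs: "quasi_standard_column X t" for t
    using assms(1) by (auto simp: quasi_standard_twisting_map_def)
  have one: "one_per_row (A_mat X t t)" for t
    using qs[of t] by (simp add: quasi_standard_column_def)
  have orthA: "orthogonal_idempotents (\<lambda>i. A_mat X i t)"
    and orthB: "orthogonal_idempotents (\<lambda>j. B_mat X j s)" for t s
    using tw by (auto simp: twisting_map_iff)
  have idA: "A_mat X i t ** A_mat X i t = A_mat X i t" and idB: "B_mat X j s ** B_mat X j s = B_mat X j s" for i t j s
    using orthA[of t] orthB[of s] by (auto simp: orthogonal_idempotents_def)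
  have B_nth: "B_mat Y j s $ t $ i = A_mat Y i t $ s $ j" for Y :: "'k ^ ('m \<times> 'n) \<Rightarrow> 'k ^ ('n \<times> 'm)" and j s t i
    by (simp add: A_mat_def B_mat_def)
  have diag_hat: "A_mat (assoc_standard X) i t $ s $ s = A_mat X i t $ s $ s" for i t s
    by (simp flip: B_mat_diag add: B_mat_assoc_standard)
  have diag_idx_hat: "diag_idx (assoc_standard X) s t = diag_idx X s t" for s t
    by (simp add: diag_idx_def diag_hat)
  have J_hat: "J_set (assoc_standard X) i t = J_set X i t" for i t
    by (simp add: J_set_def diag_hat)
  have k_v: "k \<in> J_set X u v" and "k \<notin> J_set X v v" and d: "d = col_idx (A_mat X v v) k"
    and k_u: "k \<in> J_set X u l" and k_l: "k \<notin> J_set X l l"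
    and d_v: "d \<in> J_set X v l" and d_l: "d \<notin> J_set X l l"
    using assms(6-8)
    by (auto simp: has_arrow_def quiver_def diag_idx_hat J_hat A_mat_assoc_standard diag_idx_eq_iff[OF tw qs])
  have "u \<noteq> v" "u \<noteq> l" "v \<noteq> l"
    using assms(2,3) \<open>k \<notin> J_set X v v\<close> k_l d_l k_u d_v by auto
  have ck: "ck \<in> J_set X l l"
    unfolding assms(4) by (rule col_idx_in_J_set[OF tw one])
  have neq: "k \<noteq> d" "k \<noteq> ck" "d \<noteq> ck"
    using J_set_disjoint[OF qs k_u] d_v \<open>u \<noteq> v\<close> ck k_l d_l by auto
  have row_v_k: "A_mat X v l $ k $ j = 0" for j
    by (rule row_zero_of_block_zero[OF tw qs k_u]) fact+
  have u_kd: "A_mat X u l $ k $ d = 0"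
    using assms(9) k_u d_v by (simp add: block_zero_def)
  have row_ck: "A_mat X i l $ ck $ s = 0" if "i \<noteq> l" for i s
    by (rule row_zero_on_J_set_diag[OF tw one ck that])
  \<comment> \<open>$k \in J_u(u)$, so row $k$ of $A(u,u)$ is $e_k^T$, and orthogonality kills it in $A(i,u)$.\<close>
  have row_u_k: "A_mat X i u $ k $ s = (if i = u \<and> s = k then 1 else 0)" for i s
  proof (cases "i = u")
    case True
    then show ?thesis
      using assms(2) by (simp add: one_per_row_nth[OF one] axis_nth J_set_diag_iff[OF one])
  next
    case False
    then show ?thesis using row_zero_on_J_set_diag[OF tw one assms(2)] by simp
  qed

  \<comment> \<open>The prescribed values are increments by $\pm\lambda$ because row $k$ of $A(v,l)$ and
    $A(u,l)_{kd}$ are zero.\<close>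
  have A1_u: "A_mat X1 u l = A_mat X u l + shift_mat lam k d ck"
  proof -
    have "A_mat X1 u l $ r $ s = (A_mat X u l + shift_mat lam k d ck) $ r $ s" for r s
      using val u_kd neq rest[of u l r s] \<open>u \<noteq> v\<close> by (auto simp: shift_mat_def axis_nth)
    then show ?thesis by (simp add: vec_eq_iff)
  qed
  have A1_v: "A_mat X1 v l = A_mat X v l - shift_mat lam k d ck"
  proof -
    have "A_mat X1 v l $ r $ s = (A_mat X v l - shift_mat lam k d ck) $ r $ s" for r s
      using val row_v_k neq rest[of v l r s] \<open>u \<noteq> v\<close> by (auto simp: shift_mat_def axis_nth)
    then show ?thesis by (simp add: vec_eq_iff)
  qed
  have A1: "A_mat X1 i t = A_mat X i t" if "t \<noteq> l \<or> i \<notin> {u, v}" for i t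
    using that by (auto simp: vec_eq_iff intro!: rest)
  \<comment> \<open>In the matrices $B$ the same four entries lie in row $l$, columns $u$ and $v$, of $B(c_k,k)$ and $B(d,k)$.\<close>
  have B1_ck: "B_mat X1 ck k = B_mat X ck k + shift_mat lam l v u"
  proof -
    have "B_mat X1 ck k $ t $ i = (B_mat X ck k + shift_mat lam l v u) $ t $ i" for t i
      using val row_v_k neq rest[of i t k ck] \<open>u \<noteq> v\<close> by (auto simp: shift_mat_def axis_nth B_nth)
    then show ?thesis by (simp add: vec_eq_iff)
  qed
  have B1_d: "B_mat X1 d k = B_mat X d k - shift_mat lam l v u"
  proof -
    have "B_mat X1 d k $ t $ i = (B_mat X d k - shift_mat lam l v u) $ t $ i" for t i
      using val row_v_k u_kd neq rest[of i t k d] \<open>u \<noteq> v\<close> by (auto simp: shift_mat_def axis_nth B_nth)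
    then show ?thesis by (simp add: vec_eq_iff)
  qed
  have B1: "B_mat X1 j s = B_mat X j s" if "s \<noteq> k \<or> j \<notin> {d, ck}" for j s
    using that by (auto simp: vec_eq_iff B_nth intro!: rest)

  have uu: "A_mat X u l $ k $ k = 1" using k_u by (simp add: J_set_def)
  have B_ll: "B_mat X ck k $ l $ l = 1" "B_mat X d k $ l $ l = 0"
    using neq by (simp_all add: B_nth one_per_row_nth[OF one] axis_nth assms(4))
  have B_row_u: "B_mat X j k $ u $ i = 0" if "j \<noteq> k" for j i
    using that by (simp add: B_nth row_u_k)
  let ?I = "idempotent_mat (A_mat X1 u l) \<and> idempotent_mat (A_mat X1 v l) \<and>
            idempotent_mat (B_mat X1 d k) \<and> idempotent_mat (B_mat X1 ck k)"
  \<comment> \<open>The pairs to be shifted are $(A(u,l), A(v,l))$ in the family $(A(i,l))_i$ and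
    $(B(c_k,k), B(d,k))$ in the family $(B(j,k))_j$; in the latter, row $u$ vanishes because $k \in J_u(u)$.\<close>
  have facts: "\<And>r. A_mat X u l $ r $ k = axis k 1 $ r"
    "\<And>s. A_mat X v l $ d $ s = axis d 1 $ s - axis ck 1 $ s"
    "\<And>r. B_mat X ck k $ r $ l = axis l 1 $ r"
    "\<And>s. B_mat X ck k $ v $ s = 0"
    "\<And>s. B_mat X d k $ v $ s = axis v 1 $ s - axis u 1 $ s" if ?I
  proof -
    have iA: "idempotent_mat (A_mat X u l + shift_mat lam k d ck)" "idempotent_mat (A_mat X v l - shift_mat lam k d ck)"
      and iB: "idempotent_mat (B_mat X ck k + shift_mat lam l v u)" "idempotent_mat (B_mat X d k - shift_mat lam l v u)"
      using that A1_u A1_v B1_ck B1_d by simp_all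
    show "\<And>r. A_mat X u l $ r $ k = axis k 1 $ r"
      by (rule shifted_idempotent_first(1)[OF idA _ _ _ _ uu _ iA(1)])
        (use neq assms(10) row_ck \<open>u \<noteq> l\<close> in auto)
    show "\<And>s. A_mat X v l $ d $ s = axis d 1 $ s - axis ck 1 $ s"
      by (rule shifted_idempotent_second[OF idA _ _ _ _ _ iA(2)])
        (use neq assms(10) row_ck row_v_k \<open>v \<noteq> l\<close> in auto)
    show "\<And>r. B_mat X ck k $ r $ l = axis l 1 $ r"
      by (rule shifted_idempotent_first(1)[OF idB _ _ _ _ _ _ iB(1)])
        (use neq assms(10) B_ll B_row_u \<open>u \<noteq> l\<close> \<open>v \<noteq> l\<close> \<open>u \<noteq> v\<close> in auto)
    show "\<And>s. B_mat X ck k $ v $ s = 0"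
      by (rule shifted_idempotent_first(2)[OF idB _ _ _ _ _ _ iB(1)])
        (use neq assms(10) B_ll B_row_u \<open>u \<noteq> l\<close> \<open>v \<noteq> l\<close> \<open>u \<noteq> v\<close> in auto)
    show "\<And>s. B_mat X d k $ v $ s = axis v 1 $ s - axis u 1 $ s"
      by (rule shifted_idempotent_second[OF idB _ _ _ _ _ iB(2)])
        (use neq assms(10) B_ll B_row_u \<open>u \<noteq> l\<close> \<open>v \<noteq> l\<close> \<open>u \<noteq> v\<close> in auto)
  qed

  have part1: "A_mat X1 i u $ k $ j = A_mat (assoc_standard X) i u $ k $ j \<and>
      A_mat X1 i v $ k $ j = A_mat (assoc_standard X) i v $ k $ j" if ?I for i j
  proof
    show "A_mat X1 i u $ k $ j = A_mat (assoc_standard X) i u $ k $ j"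
      using \<open>u \<noteq> l\<close> row_u_k[of i j] row_u_k[of u j]
      by (auto simp: A1 assoc_standard_def A_mat_map_of_A B_nth split: if_splits)
    \<comment> \<open>Row $v$ of $B(d,k)$ is $(e_v - e_u)^T$, so $B(d,k) B(j,k) = 0$ equates rows $u$ and $v$ of $B(j,k)$.\<close>
    have row_v: "A_mat X i v $ k $ j = 0" if "i \<noteq> v" "j \<noteq> k" "j \<noteq> d" for i j
    proof -
      have "0 = (B_mat X d k ** B_mat X j k) $ v $ i"
        using orthB[of k] that by (simp add: orthogonal_idempotents_def)
      also have "\<dots> = B_mat X j k $ v $ i - B_mat X j k $ u $ i"
        by (simp add: matrix_matrix_mult_def facts(5)[OF \<open>?I\<close>] sum_axis_diff)
      finally show ?thesis using B_row_u[OF \<open>j \<noteq> k\<close>] by (simp add: B_nth)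
    qed
    have diag_v: "A_mat X i v $ k $ k = (if i = u then 1 else 0)" for i
    proof (cases "i = u")
      case False
      then have "k \<notin> J_set X i v" using J_set_disjoint[OF qs k_v] by blast
      then show ?thesis
        using False qs[of v] unfolding quasi_standard_column_def J_set_def by auto
    qed (use k_v in \<open>simp add: J_set_def\<close>)
    show "A_mat X1 i v $ k $ j = A_mat (assoc_standard X) i v $ k $ j"
      using \<open>v \<noteq> l\<close> \<open>u \<noteq> v\<close> row_v[of i j] facts(5)[OF that, of i] neq
      by (auto simp: A1 assoc_standard_def A_mat_map_of_A B_nth diag_v one_per_row_nth[OF one] axis_nth d[symmetric])
  qed

  have part2: "quasi_standard_twisting_map X1" if ?I
  proof -
    note f = facts[OF that]
    have "orthogonal_idempotents (\<lambda>i. A_mat X1 i l)"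
      by (rule orthogonal_idempotents_shift[OF orthA, where p = u and q = v and k = k and a = d and b = ck and c = lam])
        (use neq f A1_u A1_v A1 row_ck \<open>u \<noteq> l\<close> \<open>v \<noteq> l\<close> \<open>u \<noteq> v\<close> in auto)
    then have orthA1: "orthogonal_idempotents (\<lambda>i. A_mat X1 i t)" for t
      using A1[of t] orthA[of t] by (cases "t = l") simp_all
    have "orthogonal_idempotents (\<lambda>j. B_mat X1 j k)"
      by (rule orthogonal_idempotents_shift[OF orthB, where p = ck and q = d and k = l and a = v and b = u and c = lam])
        (use neq f B1_ck B1_d B1 B_row_u \<open>u \<noteq> l\<close> \<open>v \<noteq> l\<close> \<open>u \<noteq> v\<close> in auto)
    then have orthB1: "orthogonal_idempotents (\<lambda>j. B_mat X1 j s)" for s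
      using B1[of s] orthB[of s] by (cases "s = k") simp_all
    let ?N = "shift_mat lam k d ck"
    have A1_nth: "A_mat X1 i l $ r $ s = A_mat X i l $ r $ s + (axis u 1 $ i - axis v 1 $ i) * ?N $ r $ s" for i r s
      using A1_u A1_v A1[of l i] \<open>u \<noteq> v\<close> by (cases "i = u"; cases "i = v") (auto simp: axis_nth)
    have N_sum: "(\<Sum>s\<in>UNIV. ?N $ r $ s) = 0" for r
      using sum_axis_diff[where g = "\<lambda>_. 1 :: 'k" and a = d and b = ck]
      by (simp add: shift_mat_def flip: sum_distrib_left)
    have "(\<Sum>i\<in>UNIV. A_mat X1 i t $ r $ s) = (\<Sum>i\<in>UNIV. A_mat X i t $ r $ s)" for t r s
      by (cases "t = l") (simp_all add: A1 A1_nth sum.distrib sum_axis_diff)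
    moreover have "(\<Sum>s\<in>UNIV. A_mat X1 i t $ r $ s) = (\<Sum>s\<in>UNIV. A_mat X i t $ r $ s)" for t r i
      by (cases "t = l") (simp_all add: A1 A1_nth sum.distrib N_sum flip: sum_distrib_left)
    ultimately have tw1: "twisting_map X1"
      using tw assms(11) orthA1 orthB1 by (simp add: twisting_map_iff)

    \<comment> \<open>Row $d$ of $A(v,l)$ is $(e_d - e_{c_k})^T$, so $A(v,l) A(l,l) = 0$ equates rows $d$ and $c_k$ of $A(l,l)$.\<close>
    have "0 = (A_mat X v l ** A_mat X l l) $ d $ cd"
      using orthA[of l] \<open>v \<noteq> l\<close> by (simp add: orthogonal_idempotents_def)
    also have "\<dots> = A_mat X l l $ d $ cd - A_mat X l l $ ck $ cd"
      by (simp add: matrix_matrix_mult_def f(2) sum_axis_diff)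
    finally have "A_mat X l l $ ck $ cd = 1"
      by (simp add: one_per_row_nth[OF one, of l d] axis_nth assms(5))
    moreover have "col_idx (A_mat X l l) ck = ck"
      using ck by (simp add: J_set_diag_iff[OF one])
    ultimately have cd: "col_idx (A_mat X l l) d = col_idx (A_mat X l l) k"
      by (simp add: one_per_row_nth[OF one, of l ck] axis_nth flip: assms(4,5) split: if_splits)

    have diag1: "A_mat X1 i t $ s $ s = A_mat X i t $ s $ s" for i t s
      using neq by (cases "t = l") (auto simp: A1 A1_nth shift_mat_def axis_nth)
    have J1: "J_set X1 i t = J_set X i t" for i t
      by (simp add: J_set_def diag1)
    have qs1: "quasi_standard_column X1 t" for t
    proof (cases "t = l")
      case False
      then show ?thesis
        using qs[of t] by (simp add: quasi_standard_column_def block_zero_def J1 A1)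
    next
      case [simp]: True
      have ll: "A_mat X1 l l = A_mat X l l" using A1 \<open>u \<noteq> l\<close> \<open>v \<noteq> l\<close> by simp
      have in_k: "w = u" if "k \<in> J_set X w l" for w using J_set_disjoint[OF qs k_u that] by simp
      have in_d: "w = v" if "d \<in> J_set X w l" for w using J_set_disjoint[OF qs d_v that] by simp
      have in_ck: "w = l" if "ck \<in> J_set X w l" for w using J_set_disjoint[OF qs ck that] by simp
      have old: "A_mat X1 i l $ r $ s = A_mat X i l $ r $ s"
        if "\<not> (r = k \<and> (s = d \<or> s = ck) \<and> (i = u \<or> i = v))" for i r s
        using that by (intro rest) auto
      have row_kv: "A_mat X i l $ k $ s = 0" if "s \<in> J_set X v l" "i = u \<or> i = v" for i s
        using that row_v_k assms(9) k_u by (auto simp: block_zero_def)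
      \<comment> \<open>The changed entries lie in $D^{uv}_{(u)}$, $D^{uv}_{(v)}$, $D^{ul}_{(u)}$ and $D^{ul}_{(v)}$,
        none of which is required to vanish.\<close>
      have c3: "block_zero X1 u' v' i l" if "u' \<noteq> i" "v' \<notin> {i, l}" for u' v' i
        unfolding block_zero_def J1
      proof (intro ballI)
        fix r s assume rs: "r \<in> J_set X u' l" "s \<in> J_set X v' l"
        have "A_mat X1 i l $ r $ s = A_mat X i l $ r $ s"
          using that rs in_k in_d in_ck by (intro old) auto
        also have "\<dots> = 0"
          using qs[of l] that rs by (auto simp: quasi_standard_column_def block_zero_def)
        finally show "A_mat X1 i l $ r $ s = 0" .
      qed
      \<comment> \<open>In $D^{uv}_{(u)}$ and $D^{uv}_{(v)}$ row $k$ was zero and only column $d$ has been filled;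
        column $c_k$ belongs to the blocks with $v' = l$, which are left out here.\<close>
      have c4: "s = s'"
        if "v' \<noteq> l" "r \<in> J_set X u' l" "s \<in> J_set X v' l" "s' \<in> J_set X v' l"
          "A_mat X1 i l $ r $ s \<noteq> 0" "A_mat X1 i l $ r $ s' \<noteq> 0" for u' v' i r s s'
      proof (cases "r = k \<and> v' = v \<and> (i = u \<or> i = v)")
        case True
        have "x = d" if "A_mat X1 i l $ r $ x \<noteq> 0" "x \<in> J_set X v l" for x
          using that row_kv[OF that(2), of i] old[of r x i] True in_ck[of v] \<open>v \<noteq> l\<close> by auto
        then show ?thesis using that True by blast
      next
        case False
        have "A_mat X1 i l $ r $ x = A_mat X i l $ r $ x" if "x \<in> J_set X v' l" for x
          using False that in_d in_ck \<open>v' \<noteq> l\<close> by (intro old) auto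
        then have "A_mat X i l $ r $ s \<noteq> 0" "A_mat X i l $ r $ s' \<noteq> 0" using that by auto
        then show ?thesis using qs[of l] that(1-4) unfolding quasi_standard_column_def by blast
      qed
      have c5: "col_idx (A_mat X l l) s = col_idx (A_mat X l l) r"
        if "v' \<noteq> l" "r \<in> J_set X u' l" "s \<in> J_set X v' l" "A_mat X1 i l $ r $ s \<noteq> 0" for u' v' i r s
      proof (cases "r = k \<and> s = d")
        case False
        then have "A_mat X1 i l $ r $ s = A_mat X i l $ r $ s"
          using that in_ck by (intro old) auto
        then show ?thesis using qs[of l] that unfolding quasi_standard_column_def by metis
      qed (simp add: cd)
      show ?thesis
        unfolding quasi_standard_column_def True J1 ll diag1
      proof (intro conjI)
        show "one_per_row (A_mat X l l)" by (rule one)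
        show "\<forall>i s. A_mat X i l $ s $ s \<in> {0, 1}"
          using qs[of l] unfolding quasi_standard_column_def by (elim conjE)
        show "\<forall>u v i. u \<noteq> i \<and> v \<notin> {i, l} \<longrightarrow> block_zero X1 u v i l"
          using c3 by blast
      qed (intro allI impI ballI conjI; (elim conjE)?; (rule c4 c5); assumption)
    qed
    show ?thesis using tw1 qs1 by (simp add: quasi_standard_twisting_map_def)
  qed
  have "?I" if "quasi_standard_twisting_map X1"
    using that by (auto simp: quasi_standard_twisting_map_def twisting_map_iff
        orthogonal_idempotents_def idempotent_mat_def)
  then show ?thesis using part1 part2 by blast
qed

end
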